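(* Let $G=(V,E)$ be a finite directed graph with two nonnegative edge weights, a distance $d_e\ge 0$ and a loss $l_e\ge 0$ for each $e\in E$, and fix a source node $s$ and a target node $t$. For an $s$-$t$ path $P$ write $d(P)=\sum_{e\in P} d_e$ and $l(P)=\sum_{e\in P} l_e$, and assume $d(P)>0$ for every $s$-$t$ path $P$. Let $\kappa = \frac{20}{\ln 10}\approx 8.686$ and $f(P)=l(P)+\kappa\ln d(P)$. Let $P^*$ be a dominant $s$-$t$ path, i.e. an $s$-$t$ path minimizing $f$, and set $d^*=d(P^* )$ and $\lambda^*=\kappa/d^*$. Then $P^*$ also minimizes $H_{\lambda^*}(P)=l(P)+\lambda^* d(P)$ over all $s$-$t$ paths $P$.
   Context: This models the indoor dominant path (IDP) model of wireless propagation: in the application, $G$ is a graph built from the source, measurement points and the corner points of walls of a floorplan, $d_e$ is Euclidean length and $l_e$ is the wall-penetration plus diffraction loss (in dB), so that the modeled path loss of $P$ is a constant plus $f(P)$. The constant $\kappa=\frac{10\cdot 2}{\ln 10}$ dB corresponds to free-space exponent $2$. *)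

theory Defs
  imports "Graph_Theory.Weighted_Graph"
begin

definition idp_kappa :: real where
  "idp_kappa = 20 / ln 10"

definition path_loss :: "('e \<Rightarrow> real) \<Rightarrow> ('e \<Rightarrow> real) \<Rightarrow> 'e awalk \<Rightarrow> real" where
  "path_loss l d P = wf_digraph.awalk_cost l P + idp_kappa * ln (wf_digraph.awalk_cost d P)"

definition linear_cost :: "('e \<Rightarrow> real) \<Rightarrow> ('e \<Rightarrow> real) \<Rightarrow> real \<Rightarrow> 'e awalk \<Rightarrow> real" where
  "linear_cost l d lam P = wf_digraph.awalk_cost l P + lam * wf_digraph.awalk_cost d P"

text \<open>An \<open>s\<close>-\<open>t\<close> path is a list of arcs forming a directed walk from \<open>s\<close> to \<open>t\<close> without
  repeated vertices; \<^const>\<open>is_arg_min\<close> includes membership in the feasible set.\<close>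

definition dominant_path ::
  "('v, 'e) pre_digraph \<Rightarrow> ('e \<Rightarrow> real) \<Rightarrow> ('e \<Rightarrow> real) \<Rightarrow> 'v \<Rightarrow> 'v \<Rightarrow> 'e awalk \<Rightarrow> bool" where
  "dominant_path G l d s t P \<longleftrightarrow>
    is_arg_min (path_loss l d) (\<lambda>Q. pre_digraph.apath G s Q t) P"

end

theory Submission
  imports Defs
begin

text \<open>Since \<open>ln\<close> is concave, its tangent at \<open>D p\<close> lies above it and touches it at \<open>D p\<close>; so
  replacing \<open>ln\<close> by this tangent keeps \<open>p\<close> a minimiser.\<close>

lemma is_arg_min_linearize_ln:
  fixes L D :: "'a \<Rightarrow> real" and k :: real
  assumes k: "0 \<le> k"
    and pos: "\<And>x. S x \<Longrightarrow> 0 < D x"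
    and min: "is_arg_min (\<lambda>x. L x + k * ln (D x)) S p"
  shows "is_arg_min (\<lambda>x. L x + k / D p * D x) S p"
proof -
  have p: "S p" and le: "\<And>x. S x \<Longrightarrow> L p + k * ln (D p) \<le> L x + k * ln (D x)"
    using min by (auto simp: is_arg_min_linorder)
  have "L p + k / D p * D p \<le> L x + k / D p * D x" if x: "S x" for x
  proof -
    \<comment> \<open>The tangent bound comes from \<open>ln u \<le> u - 1\<close> at the ratio
      \<open>u = D x / D p\<close>; positivity of both values lets the logarithm of the quotient
      split.\<close>
    have "ln (D x) - ln (D p) \<le> D x / D p - 1"
      using ln_le_minus_one[of "D x / D p"] pos[OF x] pos[OF p] by (simp add: ln_div)
    from mult_left_mono[OF this k]
    have "k * ln (D x) - k * ln (D p) \<le> k * (D x / D p) - k"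
      by (simp only: right_diff_distrib mult_1_right)
    \<comment> \<open>Minimality of \<open>p\<close> gives
      \<open>L p - L x \<le> k * ln (D x) - k * ln (D p)\<close>, which chains with the bound just
      shown; the constant \<open>k\<close> there is \<open>k / D p * D p\<close>.\<close>
    then show ?thesis
      using le[OF x] pos[OF p] by simp
  qed
  with p show ?thesis
    by (simp add: is_arg_min_linorder)
qed

theorem theorem1:
  fixes G :: "('v, 'e) pre_digraph"
    and d l :: "'e \<Rightarrow> real"
    and s t :: 'v
    and Pstar :: "'e awalk"
    and dstar lamstar :: real
  assumes "fin_digraph G"
    and "\<And>e. e \<in> arcs G \<Longrightarrow> 0 \<le> d e"
    and "\<And>e. e \<in> arcs G \<Longrightarrow> 0 \<le> l e"
    and "s \<in> verts G" and "t \<in> verts G"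
    and "\<And>P. pre_digraph.apath G s P t \<Longrightarrow> 0 < wf_digraph.awalk_cost d P"
    and "dominant_path G l d s t Pstar"
    and "dstar = wf_digraph.awalk_cost d Pstar"
    and "lamstar = idp_kappa / dstar"
  shows "is_arg_min (linear_cost l d lamstar) (\<lambda>P. pre_digraph.apath G s P t) Pstar"
proof -
  have kappa: "0 \<le> idp_kappa"
    by (simp add: idp_kappa_def)
  have "is_arg_min (\<lambda>P. wf_digraph.awalk_cost l P + idp_kappa * ln (wf_digraph.awalk_cost d P))
      (\<lambda>P. pre_digraph.apath G s P t) Pstar"
    using assms(7) unfolding dominant_path_def path_loss_def .
  \<comment> \<open>With \<open>L\<close> and \<open>D\<close> the costs for \<open>l\<close> and
    \<open>d\<close>, the tangent slope \<open>k / D p\<close> is exactly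
    \<open>lamstar\<close>.\<close>
  from is_arg_min_linearize_ln[OF kappa assms(6) this] show ?thesis
    unfolding linear_cost_def assms(8,9) .
qed

end
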